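(* Let $\bar\rho\in(0,1)$ and $\bar c\in\mathbb{R}$, and let $\bar\psi:[0,\sqrt2]\to\mathbb{R}$ be the curve obtained, as described in the context, from the limit curve $L=L_{\bar\rho,\bar c}$ in a rectangular box for grand canonical ensembles in the uniform (Bose) statistics. Set $\bar\psi^{1/\sqrt2}(x)=\sqrt2\,\bar\psi(x/\sqrt2)$ for $x\in[0,2]$. Let $\psi:[-1,1]\to\mathbb{R}$ be the limit curve in a rectangular box for canonical ensembles in the restricted uniform (Fermi) statistics with parameters $\rho$ and $b$, as described in the context. If the relations $\bar c=-b$ and $\bar\rho=\rho$ hold, then these limit curves are identified: $\bar\psi^{1/\sqrt2}=\psi$ except for the shift in $x$ by $1$, that is, $$\bar\psi^{1/\sqrt2}(x+1)=\psi(x)\qquad\text{for all }x\in[-1,1].$$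
   Context: Uniform statistics: for $\bar\rho\in(0,1)$ and a parameter $\bar c\in\mathbb{R}$ controlling the area, define for $t\in[0,1]$ $$h(t)=e^{-\bar ct}-e^{\bar ct}+e^{-\bar c(2-2\bar\rho-t)}-e^{-\bar c(t-2\bar\rho)},\qquad L(t)=L_{\bar\rho,\bar c}(t)=\frac1{\bar c}\log\frac{h(t)}{h(0)}.$$ The curve $t\mapsto L(t)$ is, in plane coordinates rotated by 45 degrees, the limit curve of Young diagrams for grand canonical ensembles in the uniform statistics in a box with ratio height/width equal to $\bar\rho/(1-\bar\rho)$. Rotating back, it becomes the curve $v=\phi(u)$ in the $u$-$v$ plane given implicitly by $$u=\frac1{\sqrt2}(t+L(t))\in[0,\sqrt2(1-\bar\rho)],\qquad v=\frac1{\sqrt2}(-t+L(t))\in[-\sqrt2\,\bar\rho,0],\qquad t\in[0,1].$$ Let $G_\phi(u)=u-\phi(u)$, with inverse function $G_\phi^{-1}$. The associated curve $y=\bar\psi(x)$, $x\in[0,\sqrt2]$, appearing in the restricted uniform statistics is determined by $$-\bar\psi'(x)=\frac{-\phi'(G_\phi^{-1}(x))}{1-\phi'(G_\phi^{-1}(x))},\qquad\bar\psi(\sqrt2)=0.$$ Restricted uniform statistics: let $\rho\in(0,1)$ and $m\in(-\rho(1-\rho)/2,\rho(1-\rho)/2)$. Let $\beta(x)=\frac{e^{bx}a}{e^{bx}a+(1-a)}$, $x\in[-1,1]$, where $a\in(0,1)$ and $b\in\mathbb{R}$ are determined by $\int_{-1}^1\beta(x)\,dx=2\rho$ and $\int_{-1}^1x\beta(x)\,dx=4m$,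 and let $\psi(x)=\int_x^1\beta(y)\,dy$ for $x\in[-1,1]$. The curve $\psi$ is the limit in probability, uniformly in $x\in[-1,1]$, as $\ell\to\infty$, of the scaled height functions $\frac1\ell\sum_{|k|\le\ell,\,k>\ell x}\eta_k$ when $\eta$ is uniformly distributed over all $\eta\in\{0,1\}^{\{-\ell,\ldots,\ell\}}$ with $\sum_k\eta_k=K$ and $\sum_kk\eta_k=M$, where $K=K_\ell$, $M=M_\ell$ satisfy $K/(2\ell+1)\to\rho$ and $M/(2\ell+1)^2\to m$. *)

theory Defs
  imports "HOL-Analysis.Analysis"
begin

definition bose_h :: "real \<Rightarrow> real \<Rightarrow> real \<Rightarrow> real" where
  "bose_h \<rho> c t =
     exp (- c * t) - exp (c * t) + exp (- c * (2 - 2 * \<rho> - t)) - exp (- c * (t - 2 * \<rho>))"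

text \<open>The closed formula for the limit curve is singular at \<open>c = 0\<close> (both the prefactor and
  the quotient); there the curve is understood as the limit for \<open>c \<rightarrow> 0\<close>.\<close>

definition bose_L :: "real \<Rightarrow> real \<Rightarrow> real \<Rightarrow> real" where
  "bose_L \<rho> c t =
     (if c = 0 then Lim (at 0) (\<lambda>s. (1 / s) * ln (bose_h \<rho> s t / bose_h \<rho> s 0))
      else (1 / c) * ln (bose_h \<rho> c t / bose_h \<rho> c 0))"

definition bose_u :: "real \<Rightarrow> real \<Rightarrow> real \<Rightarrow> real" where
  "bose_u \<rho> c t = (1 / sqrt 2) * (t + bose_L \<rho> c t)"

definition bose_v :: "real \<Rightarrow> real \<Rightarrow> real \<Rightarrow> real" where
  "bose_v \<rho> c t = (1 / sqrt 2) * (- t + bose_L \<rho> c t)"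

definition bose_dom :: "real \<Rightarrow> real set" where
  "bose_dom \<rho> = {0..sqrt 2 * (1 - \<rho>)}"

text \<open>\<open>bose_phi\<close>, \<open>bose_G\<close> and the derivative of \<open>bose_phi\<close> are meaningful on
  \<open>bose_dom \<rho>\<close> only; the derivative is one-sided at the two end points.\<close>

definition bose_phi :: "real \<Rightarrow> real \<Rightarrow> real \<Rightarrow> real" where
  "bose_phi \<rho> c w = bose_v \<rho> c (the_inv_into {0..1} (bose_u \<rho> c) w)"

definition bose_phi' :: "real \<Rightarrow> real \<Rightarrow> real \<Rightarrow> real" where
  "bose_phi' \<rho> c w = vector_derivative (bose_phi \<rho> c) (at w within bose_dom \<rho>)"

definition bose_G :: "real \<Rightarrow> real \<Rightarrow> real \<Rightarrow> real" where
  "bose_G \<rho> c w = w - bose_phi \<rho> c w"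

definition bose_G_inv :: "real \<Rightarrow> real \<Rightarrow> real \<Rightarrow> real" where
  "bose_G_inv \<rho> c = the_inv_into (bose_dom \<rho>) (bose_G \<rho> c)"

definition associated_curve :: "real \<Rightarrow> real \<Rightarrow> (real \<Rightarrow> real) \<Rightarrow> bool" where
  "associated_curve \<rho> c \<psi> \<longleftrightarrow>
     (\<forall>x\<in>{0..sqrt 2}. \<exists>d. (\<psi> has_real_derivative d) (at x within {0..sqrt 2}) \<and>
        - d = - bose_phi' \<rho> c (bose_G_inv \<rho> c x) / (1 - bose_phi' \<rho> c (bose_G_inv \<rho> c x))) \<and>
     \<psi> (sqrt 2) = 0"

definition rescale :: "real \<Rightarrow> (real \<Rightarrow> real) \<Rightarrow> real \<Rightarrow> real" where
  "rescale r f x = (1 / r) * f (r * x)"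

definition fermi_beta :: "real \<Rightarrow> real \<Rightarrow> real \<Rightarrow> real" where
  "fermi_beta a b x = exp (b * x) * a / (exp (b * x) * a + (1 - a))"

definition fermi_parameters :: "real \<Rightarrow> real \<Rightarrow> real \<Rightarrow> real \<Rightarrow> bool" where
  "fermi_parameters \<rho> m a b \<longleftrightarrow>
     0 < \<rho> \<and> \<rho> < 1 \<and> - (\<rho> * (1 - \<rho>) / 2) < m \<and> m < \<rho> * (1 - \<rho>) / 2 \<and>
     0 < a \<and> a < 1 \<and>
     (fermi_beta a b has_integral 2 * \<rho>) {-1..1} \<and>
     ((\<lambda>x. x * fermi_beta a b x) has_integral 4 * m) {-1..1}"

definition fermi_psi :: "real \<Rightarrow> real \<Rightarrow> real \<Rightarrow> real" where
  "fermi_psi a b x = integral {x..1} (fermi_beta a b)"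

end

theory Submission
  imports Defs "HOL-Real_Asymp.Real_Asymp"
begin

text \<open>
  Everything follows from one identity between the two curves: for \<open>c = - b\<close> and equal densities,
  \<open>L(t) = t - 2\<rho> + \<psi>(2t - 1)\<close> on \<open>[0, 1]\<close> (lemma \<open>bose_L_eq_fermi_psi\<close>). For \<open>c = 0\<close> both sides
  are \<open>t (1 - 2\<rho>)\<close>. For \<open>c \<noteq> 0\<close> it holds because \<open>h(t)\<close> is a linear combination of \<open>exp (- c t)\<close> and \<open>exp (c t)\<close>, as is
  \<open>exp (c t)\<close> times the denominator of \<open>\<beta>(2t - 1)\<close>, and the normalisation
  \<open>\<integral> \<beta> = 2\<rho>\<close> says exactly that the coefficients of the two combinations are proportional. The
  logarithm in \<open>L\<close> is then the logarithm in the antiderivative of \<open>\<beta>\<close>.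

  The identity turns the rotated coordinates into
  \<open>u'(t) = sqrt 2 (1 - \<beta>(2t - 1))\<close> and \<open>v'(t) = - sqrt 2 \<beta>(2t - 1)\<close>. Since \<open>0 < \<beta> < 1\<close>, the
  curve is the graph of a function \<open>\<phi>\<close> with slope \<open>- \<beta> / (1 - \<beta>)\<close>, and
  \<open>- \<phi>' / (1 - \<phi>') = \<beta>\<close>. Moreover \<open>u - v = sqrt 2 t\<close>, so the inverse of \<open>G\<close> at \<open>x\<close> is the
  point with parameter \<open>t = x / sqrt 2\<close>. Hence the slope of the rescaled associated curve at
  \<open>x + 1\<close> is \<open>- \<beta>(x)\<close>, which is also the slope of \<open>\<psi>\<close> at \<open>x\<close>, and both curves vanish at the right
  end point (lemmas \<open>bose_phi'_bose_u\<close>, \<open>bose_G_inv_eq\<close>, \<open>rescaled_associated_curve_eq_fermi_psi\<close>).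
\<close>

section \<open>Slope of a parametrised curve\<close>

text \<open>The quotient rule for slopes, in a form that includes one-sided derivatives at end points:
  on a compact parameter set the inverse of a continuous injection \<open>u\<close> is continuous, so the difference
  quotient in \<open>w = u s\<close> is the quotient of the difference quotients in \<open>s\<close>.\<close>

lemma has_field_derivative_parametric:
  fixes u v :: "real \<Rightarrow> real"
  assumes S: "compact S" and inj: "inj_on u S" and cont: "continuous_on S u" and t: "t \<in> S"
    and u: "(u has_field_derivative u') (at t within S)"
    and v: "(v has_field_derivative v') (at t within S)" and "u' \<noteq> 0"
  shows "((\<lambda>w. v (the_inv_into S u w)) has_field_derivative v' / u') (at (u t) within u ` S)"
proof -
  define \<tau> where "\<tau> = the_inv_into S u"
  have \<tau>u: "\<tau> (u s) = s" if "s \<in> S" for s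
    unfolding \<tau>_def by (rule the_inv_into_f_f[OF inj that])
  have "continuous_on (u ` S) \<tau>"
    unfolding \<tau>_def by (rule continuous_on_inv_into[OF cont S inj])
  then have "(\<tau> \<longlongrightarrow> t) (at (u t) within u ` S)"
    using t \<tau>u[OF t] by (metis continuous_on_def image_eqI)
  then have lim: "filterlim \<tau> (at t within S) (at (u t) within u ` S)"
    by (auto simp: filterlim_at eventually_at_filter \<tau>u intro!: always_eventually)
  have "((\<lambda>s. ((v s - v t) / (s - t)) / ((u s - u t) / (s - t))) \<longlongrightarrow> v' / u') (at t within S)"
    using u v \<open>u' \<noteq> 0\<close> unfolding has_field_derivative_iff by (intro tendsto_divide)
  then have "((\<lambda>s. (v s - v t) / (u s - u t)) \<longlongrightarrow> v' / u') (at t within S)"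
    by (rule Lim_transform_eventually) (auto simp: eventually_at_filter)
  from filterlim_compose[OF this lim]
  have "((\<lambda>w. (v (\<tau> w) - v t) / (u (\<tau> w) - u t)) \<longlongrightarrow> v' / u') (at (u t) within u ` S)" .
  then have "((\<lambda>w. (v (\<tau> w) - v (\<tau> (u t))) / (w - u t)) \<longlongrightarrow> v' / u') (at (u t) within u ` S)"
    by (rule Lim_transform_eventually)
      (auto simp: eventually_at_filter \<tau>u t intro!: always_eventually)
  then show ?thesis unfolding has_field_derivative_iff \<tau>_def .
qed

section \<open>The Fermi curve\<close>

lemma fermi_denominator_pos:
  fixes a b x :: real
  assumes "0 < a" "a < 1"
  shows "0 < exp (b * x) * a + (1 - a)"
  using assms by (simp add: add_pos_pos)

lemma fermi_beta_bounds:
  assumes "0 < a" "a < 1"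
  shows "0 < fermi_beta a b x" "fermi_beta a b x < 1"
  using fermi_denominator_pos[OF assms, of b x] assms by (auto simp: fermi_beta_def field_simps)

lemma continuous_fermi_beta:
  assumes "0 < a" "a < 1"
  shows "continuous_on S (fermi_beta a b)"
  unfolding fermi_beta_def
  using fermi_denominator_pos[OF assms]
  by (intro continuous_intros) (simp add: less_imp_neq[THEN not_sym])

lemma has_real_derivative_fermi_psi:
  assumes "0 < a" "a < 1" "x \<in> {-1..1}"
  shows "(fermi_psi a b has_real_derivative - fermi_beta a b x) (at x within {-1..1})"
  unfolding fermi_psi_def[abs_def]
  by (intro integral_has_real_derivative' continuous_fermi_beta assms)

lemma fermi_psi_closed_form:
  assumes "0 < a" "a < 1" "b \<noteq> 0" "x \<le> 1"
  shows "fermi_psi a b x = (ln (exp b * a + (1 - a)) - ln (exp (b * x) * a + (1 - a))) / b"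
proof -
  have "(fermi_beta a b has_integral
      ln (exp (b * 1) * a + (1 - a)) / b - ln (exp (b * x) * a + (1 - a)) / b) {x..1}"
    unfolding fermi_beta_def
  proof (rule fundamental_theorem_of_calculus)
    fix y assume "y \<in> {x..1}"
    show "((\<lambda>y. ln (exp (b * y) * a + (1 - a)) / b) has_vector_derivative
        exp (b * y) * a / (exp (b * y) * a + (1 - a))) (at y within {x..1})"
      unfolding has_real_derivative_iff_has_vector_derivative[symmetric]
      using fermi_denominator_pos[OF assms(1,2), of b y] \<open>b \<noteq> 0\<close>
      by (auto intro!: derivative_eq_intros)
  qed (use assms in auto)
  then show ?thesis
    by (simp add: fermi_psi_def integral_unique diff_divide_distrib)
qed

section \<open>The Bose curve in terms of the Fermi curve\<close>

text \<open>With \<open>E = exp b\<close>, \<open>R = exp (2 b \<rho>)\<close> and \<open>T = exp (b t)\<close> both sides are combinations of \<open>T\<close>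
  and \<open>1 / T\<close>; comparing either coefficient gives back the normalisation.\<close>

lemma bose_h_proportional:
  assumes norm: "exp b * a + (1 - a) = exp (2 * \<rho> * b) * (exp (- b) * a + (1 - a))"
  shows "bose_h \<rho> (- b) t * (exp (- b) * a + (1 - a)) =
    bose_h \<rho> (- b) 0 * (exp (- b * t) * (exp (b * (2 * t - 1)) * a + (1 - a)))"
proof -
  define E R T where ERT: "E = exp b" "R = exp (2 * \<rho> * b)" "T = exp (b * t)"
  have pos: "E > 0" "R > 0" "T > 0" by (auto simp: ERT)
  have h: "bose_h \<rho> (- b) s = ((R - 1) * exp (b * s) + (E * E - R) / exp (b * s)) / R" for s
    unfolding bose_h_def ERT
    by (simp add: field_simps exp_minus flip: exp_add)
  have shift: "exp (b * (2 * t - 1)) = T * T / E" "exp (- b) = 1 / E" "exp (- b * t) = 1 / T"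
    unfolding ERT by (simp_all add: exp_minus inverse_eq_divide flip: exp_add exp_diff)
      (simp add: algebra_simps)
  define D where "D = exp (- b) * a + (1 - a)"
  have RD: "R * D = E * a + (1 - a)"
    using norm by (simp add: ERT D_def)
  then have coeff: "(R - 1) * D = (E * E - 1) * (a / E)" "(E * E - R) * D = (E * E - 1) * (1 - a)"
    using pos by (simp_all add: left_diff_distrib) (simp_all add: D_def shift field_simps)
  have "bose_h \<rho> (- b) t * D = ((R - 1) * D * T + (E * E - R) * D / T) / R"
    by (simp add: h ERT(3)[symmetric] field_simps)
  also have "\<dots> = (E * E - 1) / R * (1 / T * (T * T / E * a + (1 - a)))"
    unfolding coeff using pos by (simp add: field_simps)
  also have "(E * E - 1) / R = bose_h \<rho> (- b) 0"
    by (simp add: h)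
  finally show ?thesis
    unfolding D_def shift .
qed

text \<open>The first-order expansion in \<open>s\<close> of the quotient \<open>h(t) / h(0)\<close> is \<open>1 + s t (1 - 2\<rho>)\<close>, because
  the coefficients of \<open>exp (- s t)\<close> and \<open>exp (s t)\<close> in \<open>h\<close> are in the ratio \<open>\<rho> : (1 - \<rho>)\<close> as \<open>s \<rightarrow> 0\<close>.\<close>

lemma bose_L_zero:
  assumes "0 < \<rho>" "\<rho> < 1" "0 \<le> t"
  shows "bose_L \<rho> 0 t = t * (1 - 2 * \<rho>)"
proof -
  have "((\<lambda>s. (1 / s) * ln (bose_h \<rho> s t / bose_h \<rho> s 0)) \<longlongrightarrow> t * (1 - 2 * \<rho>)) (at 0)"
  proof (cases "t = 0")
    case True
    \<comment> \<open>At \<open>s = 0\<close> the quotient is \<open>0 / 0 = 0\<close>, and \<open>ln 0 = 0\<close>.\<close>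
    have "ln (bose_h \<rho> s 0 / bose_h \<rho> s 0) = 0" for s
      by (cases "bose_h \<rho> s 0 = 0") auto
    with True show ?thesis by simp
  next
    case False
    with assms have "0 < t" by simp
    with assms(1,2) show ?thesis unfolding bose_h_def
      by real_asymp (simp_all add: field_simps)
  qed
  then show ?thesis
    unfolding bose_L_def by (simp add: tendsto_Lim)
qed

context
  fixes \<rho> a b :: real
  assumes \<rho>: "0 < \<rho>" "\<rho> < 1" and a: "0 < a" "a < 1"
    and mass: "(fermi_beta a b has_integral 2 * \<rho>) {-1..1}"
begin

lemma fermi_psi_ends: "fermi_psi a b (-1) = 2 * \<rho>" "fermi_psi a b 1 = 0"
  using mass by (simp_all add: fermi_psi_def integral_unique)

text \<open>With \<open>D\<close> the denominator of \<open>\<beta>\<close>, the normalisation reads \<open>ln D(1) - ln D(-1) = 2\<rho> b\<close>, that is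
  \<open>D(1) = exp (2\<rho> b) D(-1)\<close>, the hypothesis under which \<open>h(t) / h(0)\<close> equals
  \<open>exp (- b t) D(2t - 1) / D(-1)\<close>. Taking logarithms gives the antiderivative of \<open>\<beta>\<close>.\<close>

lemma bose_L_eq_fermi_psi:
  assumes t: "t \<in> {0..1}"
  shows "bose_L \<rho> (- b) t = t - 2 * \<rho> + fermi_psi a b (2 * t - 1)"
proof (cases "b = 0")
  case True
  have "fermi_psi a b x = a * (1 - x)" if "x \<le> 1" for x
    using that by (simp add: fermi_psi_def fermi_beta_def[abs_def] True)
  from this[of "-1"] this[of "2 * t - 1"] fermi_psi_ends(1)
  have "a = \<rho>" "fermi_psi a b (2 * t - 1) = a * (1 - (2 * t - 1))"
    using t by auto
  then show ?thesis
    using bose_L_zero[OF \<rho>, of t] t True by (simp add: algebra_simps)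
next
  case b: False
  define D where "D x = exp (b * x) * a + (1 - a)" for x
  have D: "D x > 0" for x
    unfolding D_def by (rule fermi_denominator_pos[OF a])
  have psi: "fermi_psi a b x = (ln (D 1) - ln (D x)) / b" if "x \<le> 1" for x
    using fermi_psi_closed_form[OF a b that] by (simp add: D_def)
  have lnD: "ln (D 1) = 2 * \<rho> * b + ln (D (-1))"
    using fermi_psi_ends(1) psi[of "-1"] b by (simp add: field_simps)
  then have "D 1 = exp (2 * \<rho> * b) * D (-1)"
    using D by (metis exp_add exp_ln)
  then have hD: "bose_h \<rho> (- b) t * D (-1) =
      bose_h \<rho> (- b) 0 * (exp (- b * t) * D (2 * t - 1))"
    using bose_h_proportional[of b a \<rho> t] by (simp add: D_def)
  have "bose_h \<rho> (- b) 0 \<noteq> 0"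
    using b by (simp add: bose_h_def right_diff_distrib)
  with hD D[of "-1"] have "bose_h \<rho> (- b) t / bose_h \<rho> (- b) 0 = exp (- b * t) * D (2 * t - 1) / D (-1)"
    by (simp add: field_simps)
  then have "b * bose_L \<rho> (- b) t = b * t - ln (D (2 * t - 1)) + ln (D (-1))"
    using b D[of "-1"] D[of "2 * t - 1"] unfolding bose_L_def
    by (simp add: ln_div ln_mult)
  moreover have "b * fermi_psi a b (2 * t - 1) = 2 * \<rho> * b + ln (D (-1)) - ln (D (2 * t - 1))"
    using psi[of "2 * t - 1"] t lnD b by simp
  ultimately have "b * bose_L \<rho> (- b) t = b * (t - 2 * \<rho> + fermi_psi a b (2 * t - 1))"
    by (simp add: algebra_simps)
  then show ?thesis
    using b by simp
qed

section \<open>Slope of the associated curve\<close>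

lemma has_real_derivative_bose_uv:
  assumes t: "t \<in> {0..1}"
  shows "(bose_u \<rho> (- b) has_real_derivative sqrt 2 * (1 - fermi_beta a b (2 * t - 1)))
      (at t within {0..1})" (is ?u)
    and "(bose_v \<rho> (- b) has_real_derivative - sqrt 2 * fermi_beta a b (2 * t - 1))
      (at t within {0..1})" (is ?v)
proof -
  have "((\<lambda>s. fermi_psi a b (2 * s - 1)) has_real_derivative
      - fermi_beta a b (2 * t - 1) * 2) (at t within {0..1})"
  proof (rule DERIV_image_chain[unfolded o_def, where g = "\<lambda>s. 2 * s - 1"])
    show "(fermi_psi a b has_real_derivative - fermi_beta a b (2 * t - 1))
        (at (2 * t - 1) within (\<lambda>s. 2 * s - 1) ` {0..1})"
      by (rule DERIV_subset[OF has_real_derivative_fermi_psi[OF a]]) (use t in auto)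
  qed (auto intro!: derivative_eq_intros)
  then have "((\<lambda>s. s - 2 * \<rho> + fermi_psi a b (2 * s - 1)) has_real_derivative
      1 - 2 * fermi_beta a b (2 * t - 1)) (at t within {0..1})"
    by (auto intro!: derivative_eq_intros)
  then have L: "(bose_L \<rho> (- b) has_real_derivative 1 - 2 * fermi_beta a b (2 * t - 1))
      (at t within {0..1})"
    by (rule has_field_derivative_transform_within[OF _ zero_less_one t])
      (simp add: bose_L_eq_fermi_psi)
  show ?u
    unfolding bose_u_def[abs_def]
    by (rule derivative_eq_intros L refl)+ (simp add: field_simps)
  show ?v
    unfolding bose_v_def[abs_def]
    by (rule derivative_eq_intros L refl)+ (simp add: field_simps)
qed

lemma continuous_on_bose_u: "continuous_on {0..1} (bose_u \<rho> (- b))"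
  by (rule DERIV_continuous_on) (rule has_real_derivative_bose_uv)

lemma strict_mono_on_bose_u: "strict_mono_on {0..1} (bose_u \<rho> (- b))"
proof (rule strict_mono_onI)
  fix r s :: real assume "r \<in> {0..1}" "s \<in> {0..1}" "r < s"
  show "bose_u \<rho> (- b) r < bose_u \<rho> (- b) s"
  proof (rule DERIV_pos_imp_increasing_open[where f = "bose_u \<rho> (- b)"])
    fix y assume "r < y" "y < s"
    then have "y \<in> {0<..<1}" using \<open>r \<in> _\<close> \<open>s \<in> _\<close> by auto
    then have "(bose_u \<rho> (- b) has_real_derivative sqrt 2 * (1 - fermi_beta a b (2 * y - 1))) (at y)"
      using has_real_derivative_bose_uv(1)[of y] by (simp add: at_within_Icc_at)
    moreover have "0 < sqrt 2 * (1 - fermi_beta a b (2 * y - 1))"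
      using fermi_beta_bounds(2)[OF a] by simp
    ultimately show "\<exists>d. (bose_u \<rho> (- b) has_real_derivative d) (at y) \<and> d > 0" by blast
  next
    show "continuous_on {r..s} (bose_u \<rho> (- b))"
      using \<open>r \<in> _\<close> \<open>s \<in> _\<close> by (intro continuous_on_subset[OF continuous_on_bose_u]) auto
  qed fact
qed

lemma bose_u_image: "bose_u \<rho> (- b) ` {0..1} = bose_dom \<rho>"
proof -
  have "bose_u \<rho> (- b) 0 = 0" "bose_u \<rho> (- b) 1 = sqrt 2 * (1 - \<rho>)"
    by (simp_all add: bose_u_def bose_L_eq_fermi_psi fermi_psi_ends field_simps)
  moreover have "bose_u \<rho> (- b) ` {0..1} = {bose_u \<rho> (- b) 0..bose_u \<rho> (- b) 1}"
  proof
    show "bose_u \<rho> (- b) ` {0..1} \<subseteq> {bose_u \<rho> (- b) 0..bose_u \<rho> (- b) 1}"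
      using strict_mono_on_leD[OF strict_mono_on_bose_u] by auto
    show "{bose_u \<rho> (- b) 0..bose_u \<rho> (- b) 1} \<subseteq> bose_u \<rho> (- b) ` {0..1}"
    proof
      fix w assume "w \<in> {bose_u \<rho> (- b) 0..bose_u \<rho> (- b) 1}"
      then obtain t where "0 \<le> t" "t \<le> 1" "bose_u \<rho> (- b) t = w"
        using IVT'[of "bose_u \<rho> (- b)" 0 w 1] continuous_on_bose_u by auto
      then show "w \<in> bose_u \<rho> (- b) ` {0..1}" by auto
    qed
  qed
  ultimately show ?thesis
    by (simp add: bose_dom_def)
qed

lemma the_inv_into_bose_u:
  "t \<in> {0..1} \<Longrightarrow> the_inv_into {0..1} (bose_u \<rho> (- b)) (bose_u \<rho> (- b) t) = t"
  by (rule the_inv_into_f_f[OF strict_mono_on_imp_inj_on[OF strict_mono_on_bose_u]])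

text \<open>Since the parametrisation runs exactly over the domain of \<open>\<phi>\<close>, the one-sided derivatives at the
  end points of the domain come out of the same quotient \<open>v' / u'\<close> as the interior ones.\<close>

lemma bose_phi'_bose_u:
  assumes t: "t \<in> {0..1}"
  defines "\<beta> \<equiv> fermi_beta a b (2 * t - 1)"
  shows "bose_phi' \<rho> (- b) (bose_u \<rho> (- b) t) = - \<beta> / (1 - \<beta>)"
proof -
  have \<beta>: "\<beta> < 1"
    unfolding \<beta>_def by (rule fermi_beta_bounds[OF a])
  have "(bose_phi \<rho> (- b) has_real_derivative (- sqrt 2 * \<beta>) / (sqrt 2 * (1 - \<beta>)))
      (at (bose_u \<rho> (- b) t) within bose_u \<rho> (- b) ` {0..1})"
    unfolding bose_phi_def[abs_def] \<beta>_def
    by (rule has_field_derivative_parametric[OF compact_Icc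
          strict_mono_on_imp_inj_on[OF strict_mono_on_bose_u] continuous_on_bose_u t
          has_real_derivative_bose_uv[OF t]])
      (use \<beta> in \<open>simp add: \<beta>_def\<close>)
  then have "(bose_phi \<rho> (- b) has_vector_derivative - \<beta> / (1 - \<beta>))
      (at (bose_u \<rho> (- b) t) within {0..sqrt 2 * (1 - \<rho>)})"
    unfolding has_real_derivative_iff_has_vector_derivative[symmetric] bose_u_image
    by (simp add: bose_dom_def)
  moreover have "bose_u \<rho> (- b) t \<in> {0..sqrt 2 * (1 - \<rho>)}"
    using bose_u_image t unfolding bose_dom_def by blast
  ultimately show ?thesis
    unfolding bose_phi'_def bose_dom_def using \<rho>
    by (intro vector_derivative_within_closed_interval) auto
qed

text \<open>In the rotated coordinates \<open>G\<close> reads off the parameter: \<open>u - v = sqrt 2 t\<close>.\<close>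

lemma bose_G_inv_eq:
  assumes x: "x \<in> {0..sqrt 2}"
  shows "bose_G_inv \<rho> (- b) x = bose_u \<rho> (- b) (x / sqrt 2)"
proof -
  have G: "bose_G \<rho> (- b) (bose_u \<rho> (- b) t) = sqrt 2 * t" if "t \<in> {0..1}" for t
    unfolding bose_G_def bose_phi_def the_inv_into_bose_u[OF that]
    by (simp add: bose_u_def bose_v_def field_simps)
  have inj: "inj_on (bose_G \<rho> (- b)) (bose_dom \<rho>)"
    unfolding bose_u_image[symmetric] by (auto simp: inj_on_def G)
  have t: "x / sqrt 2 \<in> {0..1}" using x by (auto simp: field_simps)
  then have "bose_u \<rho> (- b) (x / sqrt 2) \<in> bose_dom \<rho>"
    using bose_u_image by blast
  from the_inv_into_f_f[OF inj this] show ?thesis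
    unfolding bose_G_inv_def G[OF t] by simp
qed

lemma has_real_derivative_associated_curve:
  assumes \<psi>: "associated_curve \<rho> (- b) \<psi>" and x: "x \<in> {0..sqrt 2}"
  shows "(\<psi> has_real_derivative - fermi_beta a b (sqrt 2 * x - 1)) (at x within {0..sqrt 2})"
proof -
  define \<beta> where "\<beta> = fermi_beta a b (sqrt 2 * x - 1)"
  have "\<beta> < 1" unfolding \<beta>_def by (rule fermi_beta_bounds[OF a])
  have "x / sqrt 2 \<in> {0..1}" using x by (auto simp: field_simps)
  moreover have "2 * (x / sqrt 2) = sqrt 2 * x" by (simp add: field_simps)
  ultimately have slope: "bose_phi' \<rho> (- b) (bose_G_inv \<rho> (- b) x) = - \<beta> / (1 - \<beta>)"
    using bose_phi'_bose_u[of "x / sqrt 2"] by (simp add: bose_G_inv_eq[OF x] \<beta>_def)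
  have "- (- \<beta> / (1 - \<beta>)) / (1 - (- \<beta> / (1 - \<beta>))) = \<beta>"
    using \<open>\<beta> < 1\<close> by (simp add: field_simps)
  moreover obtain d where "(\<psi> has_real_derivative d) (at x within {0..sqrt 2})"
    "- d = - bose_phi' \<rho> (- b) (bose_G_inv \<rho> (- b) x) / (1 - bose_phi' \<rho> (- b) (bose_G_inv \<rho> (- b) x))"
    using \<psi> x unfolding associated_curve_def by blast
  ultimately show ?thesis
    unfolding slope \<beta>_def[symmetric] by (metis minus_minus)
qed

lemma rescaled_associated_curve_eq_fermi_psi:
  assumes \<psi>: "associated_curve \<rho> (- b) \<psi>" and x: "x \<in> {-1..1}"
  shows "rescale (1 / sqrt 2) \<psi> (x + 1) = fermi_psi a b x"
proof -
  have "((\<lambda>x. rescale (1 / sqrt 2) \<psi> (x + 1) - fermi_psi a b x) has_real_derivative 0)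
      (at x within {-1..1})" if x: "x \<in> {-1..1}" for x
  proof -
    have range: "(y + 1) / sqrt 2 \<in> {0..sqrt 2}" if "y \<in> {-1..1}" for y
      using that by (auto simp: field_simps)
    have "((\<lambda>y. \<psi> ((y + 1) / sqrt 2)) has_real_derivative
        - fermi_beta a b (sqrt 2 * ((x + 1) / sqrt 2) - 1) * (1 / sqrt 2)) (at x within {-1..1})"
    proof (rule DERIV_image_chain[unfolded o_def, where g = "\<lambda>y. (y + 1) / sqrt 2"])
      show "(\<psi> has_real_derivative - fermi_beta a b (sqrt 2 * ((x + 1) / sqrt 2) - 1))
          (at ((x + 1) / sqrt 2) within (\<lambda>y. (y + 1) / sqrt 2) ` {-1..1})"
        by (rule DERIV_subset[OF has_real_derivative_associated_curve[OF \<psi> range[OF x]]])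
          (use range in blast)
      show "((\<lambda>y. (y + 1) / sqrt 2) has_real_derivative 1 / sqrt 2) (at x within {-1..1})"
        by (intro DERIV_cdivide) (auto intro!: derivative_eq_intros)
    qed
    from DERIV_diff[OF DERIV_cmult[OF this, of "sqrt 2"] has_real_derivative_fermi_psi[OF a x, of b]]
    show ?thesis by (simp add: rescale_def)
  qed
  from has_field_derivative_zero_constant[OF convex_real_interval(5) this]
  obtain k where k: "\<forall>y\<in>{-1..1}. rescale (1 / sqrt 2) \<psi> (y + 1) - fermi_psi a b y = k" ..
  have "\<psi> (2 / sqrt 2) = 0"
    using \<psi> by (simp add: associated_curve_def real_div_sqrt)
  then have "k = 0"
    using bspec[OF k, of 1] fermi_psi_ends by (simp add: rescale_def)
  then show ?thesis using bspec[OF k x] by simp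
qed

end

theorem mainTheorem4:
  fixes \<rho>bar cbar \<rho> m a b :: real and \<psi>bar :: "real \<Rightarrow> real"
  assumes "0 < \<rho>bar" and "\<rho>bar < 1"
    and "associated_curve \<rho>bar cbar \<psi>bar"
    and "fermi_parameters \<rho> m a b"
    and "cbar = - b" and "\<rho>bar = \<rho>"
  shows "\<forall>x\<in>{-1..1}. rescale (1 / sqrt 2) \<psi>bar (x + 1) = fermi_psi a b x"
  using assms rescaled_associated_curve_eq_fermi_psi[of \<rho> a b]
  unfolding fermi_parameters_def by blast

end
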